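(* Let $\alpha = 1/\sqrt{2}$ and $\varepsilon := \left(1-2^{-1/3}\right)^{3/2}$ ($\approx 0.0937$). If $(x_0,y_0)\in[\varepsilon,1]\times[0,\sqrt{1-\varepsilon^2}]$, then the sequence $(x_n,y_n)_{n\ge 0}$ generated by the Douglas-Rachford iteration $$x_{n+1}=\frac{x_n}{\rho_n},\qquad y_{n+1}=\alpha+\left(1-\frac{1}{\rho_n}\right)y_n,\qquad \rho_n=\sqrt{x_n^2+y_n^2},$$ with starting point $(x_0,y_0)$ converges to the point $(\alpha,\alpha)$.
   Context: The iteration is the Douglas-Rachford scheme in $\mathbb{R}^2$ for the unit circle $S=\{(x,y): x^2+y^2=1\}$ and the horizontal line $L=\{(x,y): y=\alpha\}$ with $\alpha=1/\sqrt2$; the two sets intersect at $(\alpha,\alpha)$ and $(-\alpha,\alpha)$. If $x_0>0$ then $x_n>0$ and $\rho_n>0$ for all $n$, so the iteration is well defined. *)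

theory Defs
  imports "HOL-Analysis.Analysis"
begin

definition dr_alpha :: real where
  "dr_alpha = 1 / sqrt 2"

definition dr_eps :: real where
  "dr_eps = (1 - 2 powr (- 1 / 3)) powr (3 / 2)"

definition dr_rho :: "real \<times> real \<Rightarrow> real" where
  "dr_rho p = sqrt ((fst p)\<^sup>2 + (snd p)\<^sup>2)"

text \<open>
  One step of the Douglas-Rachford iteration for the unit circle and the horizontal line
  at height \<open>dr_alpha\<close>. At the origin, where the iteration is undefined, division by zero
  gives an irrelevant value; orbits starting with positive first coordinate never reach it.
\<close>

definition dr_step :: "real \<times> real \<Rightarrow> real \<times> real" where
  "dr_step p = (fst p / dr_rho p, dr_alpha + (1 - 1 / dr_rho p) * snd p)"

primrec dr_seq :: "real \<times> real \<Rightarrow> nat \<Rightarrow> real \<times> real" where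
  "dr_seq p 0 = p"
| "dr_seq p (Suc n) = dr_step (dr_seq p n)"

end

theory Submission
  imports Defs
begin

text \<open>
  For \<open>p' = dr_step p\<close>, the function \<open>V(x, y) = (y - \<alpha>)\<^sup>2 / 2 + G(\<surd>(1 - x\<^sup>2))\<close> is chosen, following
  Benoist, so that its gradient at \<open>p'\<close> is orthogonal to \<open>p - p'\<close>. It strictly decreases along
  the iteration on the strip \<open>0 < x \<le> 1\<close>, \<open>0 \<le> y\<close>, except at \<open>(\<alpha>, \<alpha>)\<close>. The value of \<open>\<epsilon>\<close> is the
  maximum of \<open>cos \<theta> - \<alpha> cot \<theta>\<close>, which is exactly what keeps the orbit in the upper half plane,
  hence in a compact rectangle, where a strict Lyapunov function forces convergence.
\<close>

lemma dr_alpha_pos: "0 < dr_alpha"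
  and dr_alpha_sq: "dr_alpha\<^sup>2 = 1 / 2"
  and dr_alpha_less: "dr_alpha < 71/100"
  and dr_alpha_less_1: "dr_alpha < 1"
proof -
  show p: "0 < dr_alpha" and q: "dr_alpha\<^sup>2 = 1 / 2"
    by (simp_all add: dr_alpha_def power_divide)
  show r: "dr_alpha < 71/100"
    by (rule power2_less_imp_less) (simp_all add: q power_divide)
  then show "dr_alpha < 1" by simp
qed

section \<open>Convergence from a strict Lyapunov function\<close>

text \<open>Along the orbit \<open>V\<close> decreases to a limit \<open>L\<close>. At any cluster
  point \<open>q\<close> continuity gives \<open>V q = L = V (T q)\<close>, which strict decrease
  allows only for \<open>q = z\<close>; a subsequence staying away from \<open>z\<close> would have
  another cluster point.\<close>

lemma lyapunov_convergence:
  fixes p :: "nat \<Rightarrow> 'a::metric_space" and V :: "'a \<Rightarrow> real"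
  assumes K: "compact K" and pK: "\<And>n. p n \<in> K"
    and step: "\<And>n. p (Suc n) = T (p n)"
    and T: "continuous_on K T" and V: "continuous_on K V"
    and dec: "\<And>x. x \<in> K \<Longrightarrow> x \<noteq> z \<Longrightarrow> V (T x) < V x"
    and fp: "T z = z"
  shows "p \<longlonglongrightarrow> z"
proof (rule ccontr)
  have "decseq (\<lambda>n. V (p n))"
    unfolding decseq_Suc_iff step by (metis dec fp pK less_imp_le order_refl)
  moreover obtain B where B: "\<And>x. x \<in> K \<Longrightarrow> B \<le> V x"
  proof -
    have "bdd_below (V ` K)"
      by (intro bounded_imp_bdd_below compact_imp_bounded compact_continuous_image V K)
    then show ?thesis using that by (auto simp: bdd_below_def)
  qed
  ultimately obtain L where L: "(\<lambda>n. V (p n)) \<longlonglongrightarrow> L"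
    using decseq_convergent[of "\<lambda>n. V (p n)" B] pK by blast
  assume "\<not> p \<longlonglongrightarrow> z"
  then obtain e where e: "e > 0" and "\<exists>\<^sub>\<infinity>n. e \<le> dist (p n) z"
    by (auto simp: tendsto_iff not_eventually frequently_cofinite[symmetric] cofinite_eq_sequentially not_less)
  then obtain r :: "nat \<Rightarrow> nat" where r: "strict_mono r" and far: "\<And>n. e \<le> dist (p (r n)) z"
    using infinite_enumerate[of "{n. e \<le> dist (p n) z}"]
    by (auto simp: frequently_cofinite)
  obtain q r' where q: "q \<in> K" and r': "strict_mono r'" and lim: "(p \<circ> r \<circ> r') \<longlonglongrightarrow> q"
    using K pK unfolding compact_def by (metis comp_apply)
  define k where "k = r \<circ> r'"
  have k: "strict_mono k" unfolding k_def by (intro strict_mono_o r r')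
  have lk: "(\<lambda>n. p (k n)) \<longlonglongrightarrow> q" using lim by (simp add: k_def o_def)
  have lT: "(\<lambda>n. p (Suc (k n))) \<longlonglongrightarrow> T q"
    unfolding step by (rule continuous_on_tendsto_compose[OF T lk q]) (simp add: pK)
  \<comment> \<open>\<open>T\<close> may send points of \<open>K\<close> outside \<open>K\<close>;
    \<open>T q\<close> is in \<open>K\<close> because it is a limit of orbit points.\<close>
  have Tq: "T q \<in> K"
    using closed_sequentially[OF compact_imp_closed[OF K] _ lT] pK by blast
  have "(\<lambda>n. V (p (k n))) \<longlonglongrightarrow> V q"
    by (rule continuous_on_tendsto_compose[OF V lk q]) (simp add: pK)
  moreover have "(\<lambda>n. V (p (k n))) \<longlonglongrightarrow> L"
    using LIMSEQ_subseq_LIMSEQ[OF L k] by (simp add: o_def)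
  ultimately have Vq: "V q = L" using LIMSEQ_unique by blast
  have "(\<lambda>n. V (p (Suc (k n)))) \<longlonglongrightarrow> V (T q)"
    by (rule continuous_on_tendsto_compose[OF V lT Tq]) (simp add: pK)
  moreover have "strict_mono (\<lambda>n. Suc (k n))" using k by (simp add: strict_mono_def)
  then have "(\<lambda>n. V (p (Suc (k n)))) \<longlonglongrightarrow> L"
    using LIMSEQ_subseq_LIMSEQ[OF L, of "\<lambda>n. Suc (k n)"] by (simp add: o_def)
  ultimately have "V (T q) = L" using LIMSEQ_unique by blast
  with Vq dec q have "q = z" by force
  moreover have "e \<le> dist q z"
  proof (rule tendsto_lowerbound)
    show "(\<lambda>n. dist (p (k n)) z) \<longlonglongrightarrow> dist q z" by (intro tendsto_intros lk)
  qed (simp_all add: k_def far)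
  ultimately show False using e by simp
qed

section \<open>The one-variable potential\<close>

text \<open>The primitive of \<open>t\<^sup>2 (t - \<alpha>) / (1 - t\<^sup>2)\<close> vanishing at \<open>0\<close>.\<close>

definition dr_G :: "real \<Rightarrow> real" where
  "dr_G t = dr_alpha * t - t\<^sup>2 / 2 - (1 + dr_alpha) / 2 * ln (1 + t) - (1 - dr_alpha) / 2 * ln (1 - t)"

lemma dr_G_deriv:
  assumes "0 \<le> t" "t < 1"
  shows "(dr_G has_real_derivative t\<^sup>2 * (t - dr_alpha) / (1 - t\<^sup>2)) (at t)"
proof -
  have nz: "1 + t \<noteq> 0" "1 - t \<noteq> 0" using assms by auto
  have poly: "((\<lambda>t. dr_alpha * t - t\<^sup>2 / 2) has_real_derivative dr_alpha - t) (at t)"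
    by (auto intro!: derivative_eq_intros)
  have ln_plus: "((\<lambda>t. ln (1 + t)) has_real_derivative 1 / (1 + t)) (at t)"
    and ln_minus: "((\<lambda>t. ln (1 - t)) has_real_derivative - 1 / (1 - t)) (at t)"
    using assms by (auto intro!: derivative_eq_intros)
  have "(dr_G has_real_derivative
      dr_alpha - t - (1 + dr_alpha) / 2 * (1 / (1 + t)) - (1 - dr_alpha) / 2 * (- 1 / (1 - t))) (at t)"
    unfolding dr_G_def by (intro DERIV_diff[OF DERIV_diff] DERIV_cmult poly ln_plus ln_minus)
  also have "dr_alpha - t - (1 + dr_alpha) / 2 * (1 / (1 + t)) - (1 - dr_alpha) / 2 * (- 1 / (1 - t))
      = t\<^sup>2 * (t - dr_alpha) / ((1 + t) * (1 - t))"
    using nz by (simp add: divide_simps) (simp add: algebra_simps power2_eq_square)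
  also have "(1 + t) * (1 - t) = 1 - t\<^sup>2" by (simp add: algebra_simps power2_eq_square)
  finally show ?thesis .
qed

lemma dr_G_continuous: "continuous_on {0..<1} dr_G"
  by (intro continuous_at_imp_continuous_on ballI DERIV_isCont[OF dr_G_deriv]) auto

section \<open>A quartic inequality\<close>

text \<open>
  Needed when \<open>r \<le> s < \<alpha>\<close> (with \<open>a = s / \<alpha>\<close>, \<open>b = r / \<alpha>\<close>). The margin is thin (about \<open>0.04\<close> near
  \<open>a = 0.83\<close>, \<open>b = 0\<close>), hence the separate sums of squares for \<open>a\<close> away from and close to \<open>1\<close>.
\<close>

lemma quartic_pos:
  fixes a b :: real
  assumes "0 \<le> b" "b \<le> a" "a < 1"
  shows "0 < 12 * (1 - a)\<^sup>2 + 4 * (a^3 - b^3) - 3 * (a^4 - b^4) - 12 * a * (1 - a) * (a\<^sup>2 - b\<^sup>2)"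
    (is "0 < ?Q")
proof (cases "a \<le> 13/15")
  case True
  have eq: "?Q = (3 * a\<^sup>2 - 4/3 * a - 1)\<^sup>2 + (146/9 * a\<^sup>2 - 80/3 * a + 11) + b\<^sup>2 * (3 * b\<^sup>2 - 4 * b + 12 * a * (1 - a))"
    by (simp add: algebra_simps power2_eq_square power3_eq_cube power4_eq_xxxx)
  have "146/9 * a\<^sup>2 - 80/3 * a + 11 = 146/9 * (a - 60/73)\<^sup>2 + 3/73"
    by (simp add: algebra_simps power2_eq_square)
  then have 1: "146/9 * a\<^sup>2 - 80/3 * a + 11 > 0"
    by (simp add: add_nonneg_pos)
  \<comment> \<open>For small \<open>a\<close> the term \<open>12 * a * (1 - a)\<close> is at least
    \<open>6 * b\<close>. Otherwise the minimum over \<open>b\<close>, at \<open>2/3\<close>,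
    requires \<open>1/9 \<le> a * (1 - a)\<close>, which still holds at
    \<open>a = 13/15\<close>.\<close>
  have 2: "0 \<le> 3 * b\<^sup>2 - 4 * b + 12 * a * (1 - a)"
  proof (cases "a \<le> 1/2")
    case True
    have "a * (1/2) \<le> a * (1 - a)" using True assms by (intro mult_left_mono) auto
    then show ?thesis using assms zero_le_power2[of b] by linarith
  next
    case False
    have "0 \<le> (a - 1/2) * (13/15 - a)" using False True by simp
    then have "a * a \<le> 41/30 * a - 13/30" by (simp add: field_simps)
    then have "1/9 \<le> a * (1 - a)" using True by (simp add: right_diff_distrib)
    moreover have "0 \<le> 3 * (b - 2/3)\<^sup>2" by simp
    ultimately show ?thesis by (simp add: algebra_simps power2_eq_square)
  qed
  show ?thesis unfolding eq
    using 1 mult_nonneg_nonneg[OF zero_le_power2[of b] 2] zero_le_power2[of "3 * a\<^sup>2 - 4/3 * a - 1"]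
    by linarith
next
  case False
  define u where "u = 1 - a"
  have a: "a = 1 - u" by (simp add: u_def)
  have u: "0 < u" "u < 2/15" using False assms by (auto simp: u_def)
  \<comment> \<open>Completing the square of the quartic in \<open>b\<close> leaves \<open>m\<close>
    free. This choice makes the discriminant expression \<open>A * B - 4 * m\<^sup>2\<close> of the
    remaining quadratic divisible by \<open>u\<^sup>2\<close>, matching the degeneration of
    \<open>?Q\<close> at \<open>a = b = 1\<close>.\<close>
  define m where "m = 5/2 * u - 1/3"
  define A where "A = 2/3 - 3 * u - 12 * u\<^sup>2"
  define B where "B = 2/3 - 7 * u + 93/4 * u\<^sup>2 - 28 * u^3 + 9 * u^4"
  have eq: "?Q = 3 * (b\<^sup>2 - 2/3 * b + m)\<^sup>2 + (A * b\<^sup>2 + 4 * m * b + B)"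
    unfolding a m_def A_def B_def
    by (simp add: algebra_simps power2_eq_square power3_eq_cube power4_eq_xxxx)
  have u2: "u\<^sup>2 < (2/15)\<^sup>2" using u by (intro power_strict_mono) auto
  have A: "A > 0" using u u2 unfolding A_def by (simp add: power2_eq_square)
  have "A * B - 4 * m\<^sup>2 = u\<^sup>2 * (7/2 - 53/12 * u - 189 * u\<^sup>2 + 309 * u^3 - 108 * u^4)"
    unfolding m_def A_def B_def
    by (simp add: algebra_simps power2_eq_square power3_eq_cube power4_eq_xxxx eval_nat_numeral)
  moreover have "7/2 - 53/12 * u - 189 * u\<^sup>2 + 309 * u^3 - 108 * u^4 > 0"
  proof -
    have "u\<^sup>2 \<le> 2/15 * u" using u by (simp add: power2_eq_square)
    moreover have "u^4 \<le> 2/15 * u^3"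
      using u mult_right_mono[of u "2/15" "u^3"] by (simp add: power4_eq_xxxx power3_eq_cube)
    \<comment> \<open>The tangent to the cube at the endpoint \<open>u = 2/15\<close>; the three
      bounds reduce the claim to a linear inequality in \<open>u\<close>.\<close>
    moreover have "u^3 \<ge> 4/75 * u - 16/3375"
    proof -
      have "u^3 - (4/75 * u - 16/3375) = (u - 2/15)\<^sup>2 * (u + 4/15)"
      by (simp add: field_simps power2_eq_square power3_eq_cube)
    moreover have "0 \<le> (u - 2/15)\<^sup>2 * (u + 4/15)" using u by (intro mult_nonneg_nonneg) auto
    ultimately show ?thesis by linarith
    qed
    ultimately show ?thesis using u by linarith
  qed
  ultimately have "A * B - 4 * m\<^sup>2 > 0" using u by simp
  moreover have "A * (A * b\<^sup>2 + 4 * m * b + B) = (A * b + 2 * m)\<^sup>2 + (A * B - 4 * m\<^sup>2)"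
    by (simp add: algebra_simps power2_eq_square)
  ultimately have "A * (A * b\<^sup>2 + 4 * m * b + B) > 0" by (simp add: add_nonneg_pos)
  then have "A * b\<^sup>2 + 4 * m * b + B > 0" using A by (simp add: zero_less_mult_iff)
  then show ?thesis unfolding eq by (simp add: add_nonneg_pos)
qed


section \<open>Bounds for the potential\<close>

lemma dr_G_min_strict:
  assumes "0 \<le> t" "t < 1" "t \<noteq> dr_alpha"
  shows "dr_G dr_alpha < dr_G t"
proof (cases "t < dr_alpha")
  case True
  show ?thesis
  proof (rule DERIV_neg_imp_decreasing_open[OF True])
    fix x assume x: "t < x" "x < dr_alpha"
    then have "x\<^sup>2 * (x - dr_alpha) / (1 - x\<^sup>2) < 0"
      using assms dr_alpha_less_1 by (intro divide_neg_pos mult_pos_neg) (auto simp: power_less_one_iff)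
    then show "\<exists>y. DERIV dr_G x :> y \<and> y < 0"
      using dr_G_deriv[of x] x assms dr_alpha_less_1 by force
  next
    show "continuous_on {t..dr_alpha} dr_G"
      using assms dr_alpha_less_1 by (intro continuous_on_subset[OF dr_G_continuous]) auto
  qed
next
  case False
  then have l: "dr_alpha < t" using assms by simp
  show ?thesis
  proof (rule DERIV_pos_imp_increasing_open[OF l])
    fix x assume x: "dr_alpha < x" "x < t"
    then have "x\<^sup>2 * (x - dr_alpha) / (1 - x\<^sup>2) > 0"
      using assms dr_alpha_pos by (intro divide_pos_pos mult_pos_pos) (auto simp: power_less_one_iff)
    then show "\<exists>y. DERIV dr_G x :> y \<and> y > 0"
      using dr_G_deriv[of x] x assms dr_alpha_pos by force
  next
    show "continuous_on {dr_alpha..t} dr_G"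
      using assms dr_alpha_pos by (intro continuous_on_subset[OF dr_G_continuous]) auto
  qed
qed

text \<open>The difference of the two derivatives has the sign of \<open>1 - 2 * x\<^sup>2\<close>,
  positive below \<open>dr_alpha\<close>. This settles the case \<open>s < r\<close>, where only the
  minimum of \<open>dr_G\<close> bounds \<open>dr_G r\<close>.\<close>

lemma dr_G_upper:
  assumes "0 \<le> s" "s < dr_alpha"
  shows "dr_G s - dr_G dr_alpha < (s - dr_alpha)\<^sup>2 / 2"
proof -
  have "dr_G s - (s - dr_alpha)\<^sup>2 / 2 < dr_G dr_alpha - (dr_alpha - dr_alpha)\<^sup>2 / 2"
  proof (rule DERIV_pos_imp_increasing_open[OF assms(2)])
    fix x assume x: "s < x" "x < dr_alpha"
    have "x\<^sup>2 < dr_alpha\<^sup>2" using x assms by (intro power_strict_mono) auto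
    then have x2: "x\<^sup>2 < 1/2" by (simp add: dr_alpha_sq)
    have "x\<^sup>2 * (x - dr_alpha) / (1 - x\<^sup>2) - (x - dr_alpha)
        = (dr_alpha - x) * (1 - 2 * x\<^sup>2) / (1 - x\<^sup>2)"
      using x2 by (simp add: field_simps)
    also have "\<dots> > 0" using x x2 by simp
    finally have pos: "0 < x\<^sup>2 * (x - dr_alpha) / (1 - x\<^sup>2) - (x - dr_alpha)" .
    have "((\<lambda>x. dr_G x - (x - dr_alpha)\<^sup>2 / 2) has_real_derivative
      x\<^sup>2 * (x - dr_alpha) / (1 - x\<^sup>2) - (x - dr_alpha)) (at x)"
      using x assms dr_alpha_less_1 by (auto intro!: derivative_eq_intros dr_G_deriv simp: field_simps)
    with pos show "\<exists>y. DERIV (\<lambda>x. dr_G x - (x - dr_alpha)\<^sup>2 / 2) x :> y \<and> y > 0"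
      by blast
  next
    show "continuous_on {s..dr_alpha} (\<lambda>x. dr_G x - (x - dr_alpha)\<^sup>2 / 2)"
      using assms dr_alpha_less_1
      by (intro continuous_intros continuous_on_subset[OF dr_G_continuous]) auto
  qed
  then show ?thesis by simp
qed

text \<open>Replacing \<open>1 / (1 - x\<^sup>2)\<close> by \<open>1\<close> in the derivative makes
  the primitive a polynomial, so that \<open>quartic_pos\<close> becomes applicable.\<close>

lemma dr_G_lower:
  assumes "0 \<le> r" "r \<le> s" "s \<le> dr_alpha"
  shows "dr_alpha * (s^3 - r^3) / 3 - (s^4 - r^4) / 4 \<le> dr_G r - dr_G s"
proof -
  have "dr_G r + (dr_alpha * r^3 / 3 - r^4 / 4) \<ge> dr_G s + (dr_alpha * s^3 / 3 - s^4 / 4)"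
  proof (rule DERIV_nonpos_imp_nonincreasing[OF assms(2)])
    fix x assume x: "r \<le> x" "x \<le> s"
    have x1: "x < 1" using x assms dr_alpha_less_1 by simp
    then have x2: "x\<^sup>2 < 1" using x assms by (simp add: power_less_one_iff)
    have "x\<^sup>2 * (x - dr_alpha) / (1 - x\<^sup>2) + x\<^sup>2 * (dr_alpha - x)
        = - ((x\<^sup>2)\<^sup>2 * (dr_alpha - x) / (1 - x\<^sup>2))"
      using x2 by (simp add: field_simps power2_eq_square)
    also have "\<dots> \<le> 0" using x x2 assms by simp
    finally have le: "x\<^sup>2 * (x - dr_alpha) / (1 - x\<^sup>2) + x\<^sup>2 * (dr_alpha - x) \<le> 0" .
    have "((\<lambda>x. dr_G x + (dr_alpha * x^3 / 3 - x^4 / 4)) has_real_derivative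
      x\<^sup>2 * (x - dr_alpha) / (1 - x\<^sup>2) + x\<^sup>2 * (dr_alpha - x)) (at x)"
      using x assms x1
      by (auto intro!: derivative_eq_intros dr_G_deriv simp: algebra_simps power2_eq_square power3_eq_cube)
    with le show "\<exists>y. DERIV (\<lambda>x. dr_G x + (dr_alpha * x^3 / 3 - x^4 / 4)) x :> y \<and> y \<le> 0"
      by blast
  qed
  then show ?thesis by (simp add: diff_divide_distrib right_diff_distrib)
qed

section \<open>Positivity of the one-step decrease\<close>

text \<open>
  The decrease of \<open>dr_V\<close> in one step from \<open>(x, y)\<close> with \<open>s = y / \<rho>\<close> and \<open>r = \<surd>(1 - x\<^sup>2)\<close>; the
  quotient of square roots is \<open>\<rho>\<close>.
\<close>

definition dr_drop :: "real \<Rightarrow> real \<Rightarrow> real" where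
  "dr_drop s r = (s - dr_alpha)\<^sup>2 / 2 + s * (s - dr_alpha) * (sqrt (1 - r\<^sup>2) / sqrt (1 - s\<^sup>2) - 1) + dr_G r - dr_G s"

text \<open>As a function of \<open>r\<close>, the drop is smallest at \<open>r = s\<close>, where
  it equals \<open>(s - dr_alpha)\<^sup>2 / 2\<close>: its derivative is nonpositive before
  \<open>s\<close> and nonnegative after it.\<close>

lemma dr_drop_high:
  assumes s: "dr_alpha < s" "s < 1" and r: "0 \<le> r" "r < 1"
  shows "0 < dr_drop s r"
proof -
  have s0: "0 < s" using s dr_alpha_pos by linarith
  have s2: "s\<^sup>2 < 1" using s s0 by (simp add: power_less_one_iff)
  define c where "c = sqrt (1 - s\<^sup>2)"
  have c: "c > 0" using s2 by (simp add: c_def)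
  have deriv: "(dr_drop s has_real_derivative
      x / (1 - x\<^sup>2) * (x * (x - dr_alpha) - s * (s - dr_alpha) * (sqrt (1 - x\<^sup>2) / c))) (at x)"
    if x: "0 \<le> x" "x < 1" for x
  proof -
    have x2: "1 - x\<^sup>2 > 0" using x by (simp add: power_less_one_iff)
    have "((\<lambda>x. sqrt (1 - x\<^sup>2)) has_real_derivative - x / sqrt (1 - x\<^sup>2)) (at x)"
      using x2 by (auto intro!: derivative_eq_intros simp: field_simps)
    from DERIV_cmult[OF DERIV_diff[OF DERIV_cdivide[OF this, of c] DERIV_const[of 1]], of "s * (s - dr_alpha)"]
    have B: "((\<lambda>r. s * (s - dr_alpha) * (sqrt (1 - r\<^sup>2) / c - 1)) has_real_derivative
        s * (s - dr_alpha) * (- x / sqrt (1 - x\<^sup>2) / c)) (at x)" by simp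
    have "(dr_drop s has_real_derivative
        s * (s - dr_alpha) * (- x / sqrt (1 - x\<^sup>2) / c) + x\<^sup>2 * (x - dr_alpha) / (1 - x\<^sup>2)) (at x)"
      unfolding dr_drop_def c_def[symmetric]
      using DERIV_diff[OF DERIV_add[OF DERIV_add[OF DERIV_const B] dr_G_deriv[OF x]] DERIV_const]
      by simp
    moreover have "x / sqrt (1 - x\<^sup>2) = x * sqrt (1 - x\<^sup>2) / (1 - x\<^sup>2)"
      using x2 by (simp add: divide_simps)
    then have "s * (s - dr_alpha) * (- x / sqrt (1 - x\<^sup>2) / c) + x\<^sup>2 * (x - dr_alpha) / (1 - x\<^sup>2)
        = x / (1 - x\<^sup>2) * (x * (x - dr_alpha) - s * (s - dr_alpha) * (sqrt (1 - x\<^sup>2) / c))"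
      using c x2 by (simp add: divide_simps) (simp add: algebra_simps power2_eq_square)
    ultimately show ?thesis by simp
  qed
  have "0 < (s - dr_alpha)\<^sup>2 / 2" using s by simp
  also have "\<dots> = dr_drop s s" using s2 by (simp add: dr_drop_def)
  also have "\<dots> \<le> dr_drop s r"
  proof (cases "r \<le> s")
    case True
    show ?thesis
    proof (rule DERIV_nonpos_imp_nonincreasing[OF True, where f = "dr_drop s"])
      fix x assume x: "r \<le> x" "x \<le> s"
      have x2: "x\<^sup>2 \<le> s\<^sup>2" using x r by (intro power_mono) auto
      have x1: "x\<^sup>2 < 1" using x2 s2 by linarith
      have "1 \<le> sqrt (1 - x\<^sup>2) / c" using x2 c by (simp add: c_def)
      then have "s * (s - dr_alpha) * 1 \<le> s * (s - dr_alpha) * (sqrt (1 - x\<^sup>2) / c)"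
        using s s0 by (intro mult_left_mono) auto
      moreover have "x * (x - dr_alpha) \<le> s * (s - dr_alpha)"
      \<comment> \<open>The map \<open>x * (x - dr_alpha)\<close> is not monotone on the whole
        interval, but it is nonpositive up to \<open>dr_alpha\<close> and increasing beyond.\<close>
      proof (cases "x \<le> dr_alpha")
        case True
        then have "x * (x - dr_alpha) \<le> 0" using x r by (simp add: mult_nonneg_nonpos)
        moreover have "0 \<le> s * (s - dr_alpha)" using s s0 by simp
        ultimately show ?thesis by simp
      next
        case False
        then show ?thesis using x r by (intro mult_mono) auto
      qed
      ultimately have "x / (1 - x\<^sup>2) * (x * (x - dr_alpha) - s * (s - dr_alpha) * (sqrt (1 - x\<^sup>2) / c)) \<le> 0"
        using x r x1 by (intro mult_nonneg_nonpos divide_nonneg_nonneg) auto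
      moreover have "0 \<le> x" "x < 1" using x r s by auto
      ultimately show "\<exists>y. DERIV (dr_drop s) x :> y \<and> y \<le> 0" using deriv by blast
    qed
  next
    case False
    show ?thesis
    proof (rule DERIV_nonneg_imp_nondecreasing[where f = "dr_drop s"])
      show "s \<le> r" using False by simp
    next
      fix x assume x: "s \<le> x" "x \<le> r"
      have x2: "s\<^sup>2 \<le> x\<^sup>2" using x s0 by (intro power_mono) auto
      have x1: "x\<^sup>2 < 1" using x s0 r by (simp add: power_less_one_iff)
      have "sqrt (1 - x\<^sup>2) / c \<le> 1" using x2 c by (simp add: c_def)
      then have "s * (s - dr_alpha) * (sqrt (1 - x\<^sup>2) / c) \<le> s * (s - dr_alpha) * 1"
        using s s0 by (intro mult_left_mono) auto
      moreover have "s * (s - dr_alpha) \<le> x * (x - dr_alpha)"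
        using x s s0 by (intro mult_mono) auto
      ultimately have "x / (1 - x\<^sup>2) * (x * (x - dr_alpha) - s * (s - dr_alpha) * (sqrt (1 - x\<^sup>2) / c)) \<ge> 0"
        using x x1 s0 by (intro mult_nonneg_nonneg[OF divide_nonneg_nonneg]) auto
      moreover have "0 \<le> x" "x < 1" using x r s0 by auto
      ultimately show "\<exists>y. DERIV (dr_drop s) x :> y \<and> y \<ge> 0" using deriv by blast
    qed
  qed
  finally show ?thesis .
qed

text \<open>The factor \<open>s - dr_alpha\<close> is now nonpositive. If \<open>s < r\<close>, the
  root quotient is at most 1 and the mixed term helps; if \<open>r \<le> s\<close>, polynomial
  bounds lead to \<open>quartic_pos\<close>.\<close>

lemma dr_drop_low:
  assumes s: "0 \<le> s" "s < dr_alpha" and r: "0 \<le> r" "r < 1"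
  shows "0 < dr_drop s r"
proof -
  have s2: "s\<^sup>2 < 1/2"
    using power_strict_mono[of s dr_alpha 2] s by (simp add: dr_alpha_sq)
  define c where "c = sqrt (1 - s\<^sup>2)"
  have c: "c > 0" "c\<^sup>2 = 1 - s\<^sup>2" using s2 by (simp_all add: c_def)
  define C where "C = sqrt (1 - r\<^sup>2)"
  have C: "C > 0" "C\<^sup>2 = 1 - r\<^sup>2" using r by (simp_all add: C_def power_less_one_iff power_le_one)
  have drop: "dr_drop s r = (s - dr_alpha)\<^sup>2 / 2 - s * (dr_alpha - s) * (C / c - 1) + dr_G r - dr_G s"
    unfolding dr_drop_def c_def[symmetric] C_def[symmetric] by (simp add: algebra_simps)
  have sa: "0 \<le> s * (dr_alpha - s)" using s by simp
  show ?thesis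
  proof (cases "r \<le> s")
    case False
    then have "s\<^sup>2 \<le> r\<^sup>2" using s by (intro power_mono) auto
    then have "C / c \<le> 1" using c(1) by (simp add: C_def c_def)
    then have "s * (dr_alpha - s) * (C / c - 1) \<le> 0" using sa by (simp add: mult_nonneg_nonpos)
    moreover have "dr_G dr_alpha \<le> dr_G r"
      using dr_G_min_strict[OF r] by (cases "r = dr_alpha") auto
    ultimately show ?thesis using dr_G_upper[OF s] unfolding drop by linarith
  next
    case True
    have rs: "r\<^sup>2 \<le> s\<^sup>2" using r True by (intro power_mono) auto
    then have cC: "c \<le> C" by (simp add: C_def c_def)
    \<comment> \<open>Since \<open>s\<^sup>2 < 1/2\<close>, the denominator satisfies
      \<open>c * (c + C) \<ge> 2 * c\<^sup>2 > 1\<close>, which removes the square roots.\<close>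
    have "c * c \<le> c * C" using c cC by simp
    then have one: "1 \<le> c * (c + C)" using c(2) s2 by (simp add: algebra_simps power2_eq_square)
    have "C / c - 1 = (C\<^sup>2 - c\<^sup>2) / (c * (c + C))"
      using c(1) C(1) by (simp add: divide_simps power2_eq_square) (simp add: algebra_simps)
    also have "\<dots> = (s\<^sup>2 - r\<^sup>2) / (c * (c + C))" using c C by simp
    also have "\<dots> \<le> (s\<^sup>2 - r\<^sup>2) / 1" using one rs by (intro divide_left_mono) auto
    finally have "C / c - 1 \<le> s\<^sup>2 - r\<^sup>2" by simp
    then have 1: "s * (dr_alpha - s) * (C / c - 1) \<le> s * (dr_alpha - s) * (s\<^sup>2 - r\<^sup>2)"
      using sa by (intro mult_left_mono) auto
    define a b where "a = s / dr_alpha" and "b = r / dr_alpha"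
    have ab: "s = dr_alpha * a" "r = dr_alpha * b" using dr_alpha_pos by (simp_all add: a_def b_def)
    have a4: "dr_alpha^4 = 1/4"
      using power_mult[of dr_alpha 2 2] by (simp add: dr_alpha_sq power_divide)
    have "48 * ((s - dr_alpha)\<^sup>2 / 2 - s * (dr_alpha - s) * (s\<^sup>2 - r\<^sup>2)
        + (dr_alpha * (s^3 - r^3) / 3 - (s^4 - r^4) / 4))
      = 24 * dr_alpha\<^sup>2 * (1 - a)\<^sup>2 + 4 * dr_alpha^4 * (4 * (a^3 - b^3) - 3 * (a^4 - b^4) - 12 * a * (1 - a) * (a\<^sup>2 - b\<^sup>2))"
      unfolding ab by (simp add: field_simps power2_eq_square power3_eq_cube power4_eq_xxxx)
    also have "\<dots> = 12 * (1 - a)\<^sup>2 + 4 * (a^3 - b^3) - 3 * (a^4 - b^4) - 12 * a * (1 - a) * (a\<^sup>2 - b\<^sup>2)"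
      unfolding a4 dr_alpha_sq by simp
    also have "\<dots> > 0"
      using quartic_pos[of b a] s r True dr_alpha_pos by (simp add: a_def b_def divide_right_mono)
    finally have "0 < (s - dr_alpha)\<^sup>2 / 2 - s * (dr_alpha - s) * (s\<^sup>2 - r\<^sup>2)
        + (dr_alpha * (s^3 - r^3) / 3 - (s^4 - r^4) / 4)"
      by (rule zero_less_mult_pos) simp
    then show ?thesis using 1 dr_G_lower[OF r(1) True less_imp_le[OF s(2)]] unfolding drop by linarith
  qed
qed

lemma dr_drop_pos:
  assumes "0 \<le> s" "s < 1" "0 \<le> r" "r < 1" "s \<noteq> dr_alpha \<or> r \<noteq> dr_alpha"
  shows "0 < dr_drop s r"
proof -
  consider "s < dr_alpha" | "s > dr_alpha" | "s = dr_alpha" "r \<noteq> dr_alpha" using assms by fastforce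
  then show ?thesis
  proof cases
    case 3
    then show ?thesis using dr_G_min_strict[of r] assms by (simp add: dr_drop_def)
  qed (use assms dr_drop_low dr_drop_high in auto)
qed

section \<open>Decrease of the Lyapunov function\<close>

definition dr_V :: "real \<times> real \<Rightarrow> real" where
  "dr_V p = (snd p - dr_alpha)\<^sup>2 / 2 + dr_G (sqrt (1 - (fst p)\<^sup>2))"

lemma dr_V_continuous: "continuous_on {p. 0 < fst p \<and> fst p \<le> 1} dr_V"
  unfolding dr_V_def
  by (intro continuous_intros continuous_on_compose2[OF dr_G_continuous]) (auto simp: power_le_one)

text \<open>The new abscissa is the cosine \<open>c\<close> of the polar angle, so the new argument
  of \<open>dr_G\<close> is the sine \<open>s\<close>. With \<open>\<rho> = x / c\<close>, expanding
  the two squares turns the decrease into \<open>dr_drop s r\<close>.\<close>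

lemma dr_V_decrease:
  assumes x: "0 < x" "x \<le> 1" and y: "0 \<le> y" and ne: "(x, y) \<noteq> (dr_alpha, dr_alpha)"
  shows "dr_V (dr_step (x, y)) < dr_V (x, y)"
proof -
  define \<rho> where "\<rho> = dr_rho (x, y)"
  have \<rho>: "\<rho> > 0" "\<rho>\<^sup>2 = x\<^sup>2 + y\<^sup>2"
    using x by (simp_all add: \<rho>_def dr_rho_def add_pos_nonneg)
  define c s r where "c = x / \<rho>" and "s = y / \<rho>" and "r = sqrt (1 - x\<^sup>2)"
  have c: "0 < c" using x \<rho> by (simp add: c_def)
  have s: "0 \<le> s" using y \<rho> by (simp add: s_def)
  have r: "0 \<le> r" "r < 1" using x by (simp_all add: r_def power_le_one)
  have cs: "c\<^sup>2 + s\<^sup>2 = 1"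
    using x \<rho> by (simp add: c_def s_def power_divide add_divide_distrib[symmetric] add_pos_nonneg)
  then have sc: "sqrt (1 - c\<^sup>2) = s" "sqrt (1 - s\<^sup>2) = c"
    using c s by (simp_all add: real_sqrt_unique eq_diff_eq add.commute)
  have "0 < c\<^sup>2" using c by simp
  then have "s\<^sup>2 < 1" using cs by linarith
  then have s1: "s < 1" using power2_less_imp_less[of s 1] by simp
  have xr: "sqrt (1 - r\<^sup>2) = x" using x by (simp add: r_def power_le_one)
  have xy: "x = \<rho> * c" "y = \<rho> * s" using \<rho> by (simp_all add: c_def s_def)
  have step: "dr_step (x, y) = (c, dr_alpha + (\<rho> - 1) * s)"
    using \<rho>(1) by (simp add: dr_step_def \<rho>_def[symmetric] c_def s_def field_simps)
  have "dr_V (x, y) - dr_V (dr_step (x, y)) = (\<rho> * s - dr_alpha)\<^sup>2 / 2 - ((\<rho> - 1) * s)\<^sup>2 / 2 + dr_G r - dr_G s"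
    unfolding step unfolding dr_V_def fst_conv snd_conv sc r_def[symmetric] xy(2) by simp
  also have "\<dots> = dr_drop s r"
    unfolding dr_drop_def xr sc using c xy(1) by (simp add: field_simps power2_eq_square)
  also have "dr_drop s r > 0"
  proof (rule dr_drop_pos[OF s s1 r], rule ccontr)
    assume "\<not> (s \<noteq> dr_alpha \<or> r \<noteq> dr_alpha)"
    then have eq: "s = dr_alpha" "r = dr_alpha" by auto
    then have "x = sqrt (1/2)" "c = sqrt (1/2)" using xr sc(2) dr_alpha_sq by auto
    moreover have "sqrt (1/2) = dr_alpha" by (simp add: dr_alpha_def real_sqrt_divide)
    ultimately show False using xy ne eq dr_alpha_pos by auto
  qed
  finally show ?thesis by simp
qed

section \<open>The constant epsilon and the invariant region\<close>

text \<open>With \<open>w = 2 powr (- 1/3)\<close>, \<open>dr_eps\<close> and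
  \<open>dr_alpha\<close> are the cubes of \<kappa> and \<mu>, where
  \<open>\<kappa>\<^sup>2 + \<mu>\<^sup>2 = 1\<close>. The last claim says
  \<open>1 \<le> \<kappa>^3 / c + \<mu>^3 / s\<close> on the circle, with equality at
  \<open>c = \<kappa>\<close>, \<open>s = \<mu>\<close>.\<close>

lemma dr_eps_bounds: "0 < dr_eps" "dr_eps\<^sup>2 \<le> 1/8"
  and dr_eps_tangent: "0 < c \<Longrightarrow> 0 < s \<Longrightarrow> c\<^sup>2 + s\<^sup>2 = 1 \<Longrightarrow> c * (s - dr_alpha) \<le> dr_eps * s"
proof -
  define w :: real where "w = 2 powr (- 1/3)"
  have w3: "w^3 = 1/2" unfolding w_def by (subst powr_power) (simp_all add: powr_minus)
  have w0: "w > 0" by (simp add: w_def)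
  have w1: "w < 1"
  proof (rule ccontr)
    assume "\<not> w < 1"
    then have "1 \<le> w^3" by simp
    then show False using w3 by simp
  qed
  have w2: "w \<ge> 1/2"
    using power_mono_iff[of "1/2" w 3] w0 w3 by (simp add: power_divide)
  define \<kappa> \<mu> where "\<kappa> = sqrt (1 - w)" and "\<mu> = sqrt w"
  have km: "\<kappa> > 0" "\<mu> > 0" "\<kappa>\<^sup>2 = 1 - w" "\<mu>\<^sup>2 = w" using w0 w1 by (simp_all add: \<kappa>_def \<mu>_def)
  have eps: "dr_eps = \<kappa>^3"
    using w1 powr_power[of "1 - w" "1/2" 3]
    unfolding dr_eps_def w_def[symmetric] by (simp add: \<kappa>_def powr_half_sqrt)
  have al: "dr_alpha = \<mu>^3"
  proof (rule power2_eq_imp_eq)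
    have "(\<mu>^3)\<^sup>2 = (\<mu>\<^sup>2)^3" by (simp add: power_mult[symmetric])
    then show "dr_alpha\<^sup>2 = (\<mu>^3)\<^sup>2" by (simp add: km w3 dr_alpha_sq)
  qed (use km dr_alpha_pos in auto)
  show "0 < dr_eps" unfolding eps by (rule zero_less_power) (fact km)
  have "dr_eps\<^sup>2 = (\<kappa>\<^sup>2)^3" by (simp add: eps power_mult[symmetric])
  also have "\<dots> \<le> (1/2)^3" using w1 w2 unfolding km by (intro power_mono) auto
  finally show "dr_eps\<^sup>2 \<le> 1/8" by (simp add: power_divide)
  assume c: "0 < c" and s: "0 < s" and cs: "c\<^sup>2 + s\<^sup>2 = 1"
  \<comment> \<open>\<open>k^3 / t\<close> is convex in \<open>t\<^sup>2\<close>; the left side is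
    its tangent at \<open>k\<^sup>2\<close>. Summing over both pairs gives
    \<open>3/2 - 1/2 = 1\<close>.\<close>
  have tangent: "k\<^sup>2 * (3/2) - t\<^sup>2 / 2 \<le> k^3 / t" if "0 < k" "0 < t" for k t :: real
  proof -
    have "0 \<le> (t - k)\<^sup>2 * (t + 2 * k)" using that by simp
    also have "\<dots> = 2 * (k^3 - (k\<^sup>2 * (3/2) - t\<^sup>2 / 2) * t)"
      by (simp add: algebra_simps power2_eq_square power3_eq_cube)
    finally show ?thesis using that by (simp add: pos_le_divide_eq)
  qed
  have "1 \<le> \<kappa>^3 / c + \<mu>^3 / s"
    using tangent[OF km(1) c] tangent[OF km(2) s] km(3,4) cs by linarith
  then have "1 * (c * s) \<le> (dr_eps / c + dr_alpha / s) * (c * s)"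
    using c s eps al by (intro mult_right_mono) auto
  moreover have "(dr_eps / c + dr_alpha / s) * (c * s) = dr_eps * s + dr_alpha * c"
    using c s by (simp add: field_simps)
  ultimately show "c * (s - dr_alpha) \<le> dr_eps * s" by (simp add: algebra_simps)
qed

text \<open>The square alone is not invariant: the cone \<open>\<epsilon> \<rho> \<le> x\<close> keeps the next abscissa above \<open>\<epsilon>\<close>.\<close>

definition dr_region :: "(real \<times> real) set" where
  "dr_region = {dr_eps..1} \<times> {0..1} \<inter> {p. dr_eps * dr_rho p \<le> fst p}"

lemma dr_coneI:
  assumes "0 \<le> x" "dr_eps\<^sup>2 * y\<^sup>2 \<le> (1 - dr_eps\<^sup>2) * x\<^sup>2"
  shows "dr_eps * dr_rho (x, y) \<le> x"
proof (rule power2_le_imp_le)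
  show "(dr_eps * dr_rho (x, y))\<^sup>2 \<le> x\<^sup>2"
    using assms by (simp add: dr_rho_def power_mult_distrib algebra_simps)
qed (use assms in auto)

text \<open>The cone condition bounds the new abscissa below, and \<open>dr_eps_tangent\<close>
  keeps the ordinate nonnegative. The upper bound and the new cone condition follow by cases on
  \<open>\<rho>\<close> and \<open>c\<close>.\<close>

lemma dr_step_region:
  assumes "p \<in> dr_region"
  shows "dr_step p \<in> dr_region"
proof -
  obtain x y where p: "p = (x, y)" by force
  define \<rho> where "\<rho> = dr_rho p"
  have x: "dr_eps \<le> x" "0 < x" "x \<le> 1" and y: "0 \<le> y" "y \<le> 1" and cone: "dr_eps * \<rho> \<le> x"
    using assms dr_eps_bounds(1) by (auto simp: dr_region_def p \<rho>_def)
  have \<rho>: "\<rho> > 0" "\<rho>\<^sup>2 = x\<^sup>2 + y\<^sup>2"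
    using x by (simp_all add: \<rho>_def dr_rho_def p add_pos_nonneg)
  define c s where "c = x / \<rho>" and "s = y / \<rho>"
  have c: "0 < c" using x \<rho> by (simp add: c_def)
  have s: "0 \<le> s" using y \<rho> by (simp add: s_def)
  have xy: "x = \<rho> * c" "y = \<rho> * s" using \<rho> by (simp_all add: c_def s_def)
  have cs: "c\<^sup>2 + s\<^sup>2 = 1"
    using x \<rho> by (simp add: c_def s_def power_divide add_divide_distrib[symmetric] add_pos_nonneg)
  have c1: "c \<le> 1" using power2_le_imp_le[of c 1] cs zero_le_power2[of s] by simp
  have ce: "dr_eps \<le> c" using cone \<rho> by (simp add: c_def pos_le_divide_eq)
  define y' where "y' = dr_alpha + (\<rho> - 1) * s"
  have step: "dr_step p = (c, y')"
    using \<rho>(1) by (simp add: p dr_step_def \<rho>_def[unfolded p, symmetric] c_def s_def y'_def field_simps)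
  have y'_alt: "y' = dr_alpha + y - s" using xy by (simp add: y'_def algebra_simps)
  have y'0: "0 \<le> y'"
  proof (cases "s = 0")
    case False
    then have "c * (s - dr_alpha) \<le> dr_eps * s" using s c cs by (intro dr_eps_tangent) auto
    also have "\<dots> \<le> x * s" using x s by (intro mult_right_mono) auto
    also have "\<dots> = c * y" using xy by simp
    finally have "s - dr_alpha \<le> y" using c by simp
    then show ?thesis by (simp add: y'_alt)
  qed (use dr_alpha_pos in \<open>simp add: y'_def\<close>)
  have y'1: "y' \<le> 1 \<and> dr_eps\<^sup>2 * y'\<^sup>2 \<le> (1 - dr_eps\<^sup>2) * c\<^sup>2"
  proof (cases "\<rho> \<le> 1")
    case True
    then have ya: "y' \<le> dr_alpha" using s by (simp add: y'_def mult_nonpos_nonneg)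
    then have "y'\<^sup>2 \<le> 1/2" using y'0 power_mono[of y' dr_alpha 2] by (simp add: dr_alpha_sq)
    then have "dr_eps\<^sup>2 * y'\<^sup>2 \<le> c\<^sup>2 * (1 - dr_eps\<^sup>2)"
      using ce dr_eps_bounds by (intro mult_mono power_mono) auto
    then show ?thesis using ya dr_alpha_less_1 by (simp add: mult.commute)
  next
    case False
    \<comment> \<open>In the unit square \<open>1 / \<rho>\<close> is at least
      \<open>dr_alpha\<close>, so \<open>1 - y'\<close> is at least
      \<open>(1 - dr_alpha) * (1 - y)\<close>.\<close>
    have "\<rho>\<^sup>2 \<le> 1 + 1" unfolding \<rho>(2) using x y by (intro add_mono) (auto simp: power_le_one)
    then have "\<rho> \<le> sqrt 2" by (simp add: real_le_rsqrt)
    then have "dr_alpha \<le> 1 / \<rho>" using \<rho>(1) by (simp add: dr_alpha_def frac_le)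
    then have "dr_alpha * y \<le> s" using y mult_right_mono[of dr_alpha "1/\<rho>" y] by (simp add: s_def)
    then have "1 - y' \<ge> (1 - dr_alpha) * (1 - y)" by (simp add: y'_alt algebra_simps)
    moreover have "(1 - dr_alpha) * (1 - y) \<ge> 0" using y dr_alpha_less_1 by simp
    ultimately have y'1: "y' \<le> 1" by linarith
    have "dr_eps\<^sup>2 * y'\<^sup>2 \<le> (1 - dr_eps\<^sup>2) * c\<^sup>2"
    \<comment> \<open>For large \<open>c\<close> the bound on \<open>dr_eps\<close> suffices. For
      small \<open>c\<close> the sine exceeds \<open>43/50\<close>, so
      \<open>y' \<le> 71/100 + 1 - 43/50 = 17/20\<close>, and \<open>dr_eps \<le> c\<close>
      finishes.\<close>
    proof (cases "c \<ge> 1/2")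
      case True
      have "dr_eps\<^sup>2 * y'\<^sup>2 \<le> 1/8 * 1"
        using dr_eps_bounds y'0 y'1 by (intro mult_mono) (auto simp: power_le_one)
      also have "\<dots> \<le> 7/8 * (1/2)\<^sup>2" by (simp add: power_divide)
      also have "\<dots> \<le> (1 - dr_eps\<^sup>2) * c\<^sup>2"
        using dr_eps_bounds True by (intro mult_mono power_mono) auto
      finally show ?thesis .
    next
      case False
      then have "c\<^sup>2 \<le> (1/2)\<^sup>2" using c by (intro power_mono) auto
      then have "s\<^sup>2 \<ge> (43/50)\<^sup>2" using cs by (simp add: power_divide)
      then have "s \<ge> 43/50" using s power2_le_imp_le by blast
      then have "y' \<le> 17/20" using y dr_alpha_less by (simp add: y'_alt)
      then have "y'\<^sup>2 \<le> (17/20)\<^sup>2" using y'0 by (intro power_mono) auto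
      then have "dr_eps\<^sup>2 * y'\<^sup>2 \<le> c\<^sup>2 * (1 - dr_eps\<^sup>2)"
        using ce dr_eps_bounds by (intro mult_mono power_mono) (auto simp: power_divide)
      then show ?thesis by (simp add: mult.commute)
    qed
    with y'1 show ?thesis by simp
  qed
  then show ?thesis
    using ce c c1 y'0 dr_coneI[of c y'] by (simp add: step dr_region_def)
qed

section \<open>Convergence of the orbit\<close>

lemma dr_step_fixed: "dr_step (dr_alpha, dr_alpha) = (dr_alpha, dr_alpha)"
  by (simp add: dr_step_def dr_rho_def dr_alpha_sq)

theorem theorem2p1:
  fixes x0 y0 :: real
  assumes "(x0, y0) \<in> {dr_eps..1} \<times> {0..sqrt (1 - dr_eps\<^sup>2)}"
  shows "dr_seq (x0, y0) \<longlonglongrightarrow> (dr_alpha, dr_alpha)"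
proof -
  have x: "dr_eps \<le> x0" "x0 \<le> 1" and y: "0 \<le> y0" "y0 \<le> sqrt (1 - dr_eps\<^sup>2)"
    using assms by auto
  have e: "0 < dr_eps" "dr_eps\<^sup>2 \<le> 1/8" by (fact dr_eps_bounds)+
  \<comment> \<open>The starting rectangle lies in the cone: its extreme corner
    \<open>(dr_eps, sqrt (1 - dr_eps\<^sup>2))\<close> is on the unit circle and on the cone's
    boundary.\<close>
  have "y0\<^sup>2 \<le> (sqrt (1 - dr_eps\<^sup>2))\<^sup>2" using y by (intro power_mono) auto
  then have y2: "y0\<^sup>2 \<le> 1 - dr_eps\<^sup>2" using e by simp
  then have "dr_eps\<^sup>2 * y0\<^sup>2 \<le> x0\<^sup>2 * (1 - dr_eps\<^sup>2)"
    using x e by (intro mult_mono power_mono) auto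
  then have "dr_eps * dr_rho (x0, y0) \<le> x0"
    using x e by (intro dr_coneI) (auto simp: mult.commute)
  moreover have "y0 \<le> 1" using power2_le_imp_le[of y0 1] y2 zero_le_power2[of dr_eps] by simp
  ultimately have start: "(x0, y0) \<in> dr_region" using x y by (simp add: dr_region_def)
  have region: "dr_seq (x0, y0) n \<in> dr_region" for n
    by (induction n) (simp_all add: start dr_step_region)
  have pos: "0 < fst p" if "p \<in> {dr_eps..1} \<times> {0..1}" for p :: "real \<times> real"
    using that e by auto
  show ?thesis
  \<comment> \<open>The decrease holds on the whole rectangle, although a step may leave it; the
    cone serves to keep this orbit inside.\<close>
  proof (rule lyapunov_convergence[where K = "{dr_eps..1} \<times> {0..1}" and T = dr_step and V = dr_V])
    show "compact ({dr_eps..1} \<times> {0..1::real})" by (intro compact_Times compact_Icc)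
    show "dr_seq (x0, y0) n \<in> {dr_eps..1} \<times> {0..1}" for n
      using region[of n] by (simp add: dr_region_def)
    have "dr_rho p \<noteq> 0" if "p \<in> {dr_eps..1} \<times> {0..1}" for p
      using pos[OF that] by (simp add: dr_rho_def sum_power2_eq_zero_iff)
    moreover have "continuous_on A dr_rho" for A
      unfolding dr_rho_def by (intro continuous_intros)
    ultimately show "continuous_on ({dr_eps..1} \<times> {0..1}) dr_step"
      unfolding dr_step_def by (intro continuous_intros) auto
    show "continuous_on ({dr_eps..1} \<times> {0..1}) dr_V"
      using pos by (intro continuous_on_subset[OF dr_V_continuous]) auto
    show "dr_V (dr_step p) < dr_V p"
      if "p \<in> {dr_eps..1} \<times> {0..1}" "p \<noteq> (dr_alpha, dr_alpha)" for p
      using that pos[OF that(1)] by (cases p) (auto intro!: dr_V_decrease)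
  qed (simp_all add: dr_step_fixed)
qed

end
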